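(* Let $b_1$ satisfy $-\tfrac12<b_1<0$. Then there exists $\delta>0$ such that for every $\alpha\in(\pi-\delta,\pi)$ the following holds for the function $F=F_{\alpha,b_1}$ defined in the context: if $u:\mathbb{C}\to\mathbb{C}$ is an entire analytic function such that $u\,e^{F}\in L_2(\mathbb{C})$ or $u\,e^{-F}\in L_2(\mathbb{C})$, then $u\equiv 0$.
   Context: Identify $\mathbb{R}^2$ with $\mathbb{C}$ by $z=x_1+ix_2$; $L_2(\mathbb{C})$ is taken with respect to Lebesgue measure. For $0<\alpha<\pi$ let $\Omega_1=\{z\neq 0:\arg z\in(0,\alpha)\}$ and let $\Omega_2$ be the complementary sector. Let $b_1<0$ and (by normalization) $b_2=1$. The field is $B=2b_1$ in $\Omega_1$ and $B=2b_2=2$ in $\Omega_2$. Put $c_0=1-b_1$ and let $\phi(z)=b_1x_2^2$ for $z\in\Omega_1$, $\phi(z)=x_2^2$ for $z\in\Omega_2$. Let $\log z$ denote the branch of the logarithm continuous in $\mathbb{C}\setminus L_\alpha$, $L_\alpha=\{\arg z=\alpha\}$ (together with the origin), with imaginary part in $[\alpha,\alpha+2\pi)$. The potential is $$F(z)=\phi(z)-\frac{c_0\sin\alpha}{2\pi}\,\mathrm{Re}\left(\left(ze^{-i\alpha/2}\right)^2\log z\right).$$ The function $F$ (extended by continuity to $L_\alpha$ and to the origin) is continuously differentiable and satisfies $\Delta F=B$ in the sense of distributions. *)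

theory Defs
  imports "HOL-Complex_Analysis.Complex_Analysis"
begin

definition Omega1 :: "real \<Rightarrow> complex set" where
  "Omega1 \<alpha> = {z. z \<noteq> 0 \<and> 0 < Arg2pi z \<and> Arg2pi z < \<alpha>}"

definition c0 :: "real \<Rightarrow> real" where
  "c0 b\<^sub>1 = 1 - b\<^sub>1"

text \<open>The second clause also covers the two boundary rays and the origin; on the ray of
  argument \<open>\<alpha>\<close> this is the choice matching the half-open range of the logarithm below, so that
  the potential is continuous everywhere, see \<open>continuous_F_pot\<close>.\<close>

definition phi :: "real \<Rightarrow> real \<Rightarrow> complex \<Rightarrow> real" where
  "phi \<alpha> b\<^sub>1 z = (if z \<in> Omega1 \<alpha> then b\<^sub>1 * (Im z)\<^sup>2 else (Im z)\<^sup>2)"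

text \<open>The branch of the logarithm with imaginary part in \<open>[\<alpha>, \<alpha> + 2\<pi>)\<close>, cut along the ray of
  argument \<open>\<alpha>\<close>; \<^const>\<open>Arg2pi\<close> takes values in \<open>[0, 2\<pi>)\<close>.\<close>

definition log_branch :: "real \<Rightarrow> complex \<Rightarrow> complex" where
  "log_branch \<alpha> z = Complex (ln (cmod z)) (\<alpha> + Arg2pi (z * cis (- \<alpha>)))"

definition F_pot :: "real \<Rightarrow> real \<Rightarrow> complex \<Rightarrow> real" where
  "F_pot \<alpha> b\<^sub>1 z =
     phi \<alpha> b\<^sub>1 z - c0 b\<^sub>1 * sin \<alpha> / (2 * pi) * Re ((z * cis (- \<alpha> / 2))\<^sup>2 * log_branch \<alpha> z)"

definition in_L2 :: "(complex \<Rightarrow> complex) \<Rightarrow> bool" where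
  "in_L2 f \<longleftrightarrow> f \<in> borel_measurable lebesgue \<and> integrable lebesgue (\<lambda>z. (cmod (f z))\<^sup>2)"

lemma log_branch:
  assumes "z \<noteq> 0"
  shows "exp (log_branch \<alpha> z) = z" "\<alpha> \<le> Im (log_branch \<alpha> z)" "Im (log_branch \<alpha> z) < \<alpha> + 2 * pi"
proof -
  let ?w = "z * cis (- \<alpha>)"
  have "exp (log_branch \<alpha> z) = complex_of_real (cmod z) * cis \<alpha> * cis (Arg2pi ?w)"
    using assms by (simp add: log_branch_def exp_eq_polar cis_mult flip: exp_of_real)
  also have "\<dots> = cis \<alpha> * (complex_of_real (cmod ?w) * exp (\<i> * of_real (Arg2pi ?w)))"
    by (simp add: norm_mult cis_conv_exp)
  also have "\<dots> = z"
    using Arg2pi_eq[of ?w] by (simp add: mult.left_commute cis_mult)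
  finally show "exp (log_branch \<alpha> z) = z" .
qed (use Arg2pi[of "z * cis (- \<alpha>)"] in \<open>auto simp: log_branch_def\<close>)

lemma Omega1_iff:
  assumes "0 < \<alpha>" "\<alpha> < pi"
  shows "z \<in> Omega1 \<alpha> \<longleftrightarrow> 0 < Im z \<and> Im (z * cis (- \<alpha>)) < 0"
proof (cases "z = 0")
  case False
  define t where "t = Arg2pi z"
  have z: "z = complex_of_real (cmod z) * cis t"
    using Arg2pi_eq[of z] by (simp add: t_def cis_conv_exp)
  have t: "0 \<le> t" "t < 2 * pi"
    using Arg2pi[of z] by (auto simp: t_def)
  have w: "Im (z * cis (- \<alpha>)) = cmod z * sin (t - \<alpha>)"
    by (subst z) (simp add: sin_diff algebra_simps)
  show ?thesis
  proof
    assume "z \<in> Omega1 \<alpha>"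
    then have *: "0 < t" "t < \<alpha>"
      by (auto simp: Omega1_def t_def)
    then have "0 < Im z"
      using assms Arg2pi_lt_pi[of z] by (simp add: t_def)
    moreover have "sin (t - \<alpha>) < 0"
      using * assms sin_gt_zero[of "\<alpha> - t"] sin_minus[of "\<alpha> - t"] by simp
    ultimately show "0 < Im z \<and> Im (z * cis (- \<alpha>)) < 0"
      unfolding w using False by (simp add: mult_pos_neg)
  next
    assume *: "0 < Im z \<and> Im (z * cis (- \<alpha>)) < 0"
    then have t2: "0 < t" "t < pi"
      using Arg2pi_lt_pi[of z] by (auto simp: t_def)
    have "t < \<alpha>"
    proof (rule ccontr)
      assume "\<not> t < \<alpha>"
      then have "0 \<le> sin (t - \<alpha>)"
        using t2 assms by (intro sin_ge_zero) auto
      then show False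
        using * unfolding w by (simp add: mult_less_0_iff)
    qed
    then show "z \<in> Omega1 \<alpha>"
      using False t2 by (simp add: Omega1_def t_def)
  qed
qed (auto simp: Omega1_def)

text \<open>The values assigned on the ray of argument \<open>\<alpha>\<close> and at the origin are the continuous
  extension: the jumps of the two summands of the potential cancel there.\<close>

lemma continuous_F_pot:
  assumes "0 < \<alpha>" "\<alpha> < pi"
  shows "continuous_on UNIV (F_pot \<alpha> b\<^sub>1)"
proof -
  define k where "k = c0 b\<^sub>1 * sin \<alpha> / (2 * pi)"
  define w where "w = (\<lambda>z. z * cis (- \<alpha>))"
  define q where "q = (\<lambda>z. (z * cis (- \<alpha> / 2))\<^sup>2)"
  define G1 where
    "G1 = (\<lambda>z. (Im z)\<^sup>2 - k * Re (q z * Complex (ln (cmod z)) (\<alpha> + Arg2pi (w z))))"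
  define G2 where
    "G2 = (\<lambda>z. (Im z)\<^sup>2 - c0 b\<^sub>1 * (max 0 (Im z))\<^sup>2
       - k * Re (q z * Complex (ln (cmod z)) (\<alpha> + pi + Arg2pi (- w z))))"
  have w0 [simp]: "w z = 0 \<longleftrightarrow> z = 0" for z
    by (simp add: w_def)
  have q: "q z = z * w z" for z
    by (simp add: q_def w_def power2_eq_square cis_mult mult.assoc mult.left_commute)
  have F: "F_pot \<alpha> b\<^sub>1 z = phi \<alpha> b\<^sub>1 z - k * Re (q z * log_branch \<alpha> z)" for z
    by (simp only: F_pot_def k_def q_def)
  have F1: "F_pot \<alpha> b\<^sub>1 z = G1 z" if "0 \<le> Im (w z)" for z
    using that Omega1_iff[OF assms, of z]
    by (simp add: F_pot_def phi_def G1_def k_def q_def w_def log_branch_def)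
  have neg: "Arg2pi x = pi + Arg2pi (- x)" if "Im x < 0" for x
  proof -
    have "pi < Arg2pi x"
      using that Arg2pi_le_pi[of x] by linarith
    then show ?thesis
      using Arg2pi_minus[of x] that by (cases "x = 0") auto
  qed
  have F2: "F_pot \<alpha> b\<^sub>1 z = G2 z" if le: "Im (w z) \<le> 0" and z: "z \<noteq> 0" for z
  proof (cases "Im (w z) < 0")
    case True
    then have "z \<in> Omega1 \<alpha> \<longleftrightarrow> 0 < Im z"
      using Omega1_iff[OF assms, of z] by (simp add: w_def)
    then show ?thesis
      using neg[OF True]
      by (auto simp: F_pot_def phi_def G2_def k_def q_def w_def log_branch_def c0_def
          max_def algebra_simps)
  next
    case False
    with le have im: "Im (w z) = 0" by simp
    define x where "x = Re (w z)"
    have wx: "w z = of_real x" using im by (simp add: x_def complex_eq_iff)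
    have zx: "z = of_real x * cis \<alpha>"
      using wx by (simp add: w_def cis_mult flip: wx)
    have x0: "x \<noteq> 0" using z wx w0[of z] by auto
    have A: "Arg2pi (w z) = (if x < 0 then pi else 0)" "Arg2pi (- w z) = (if x < 0 then 0 else pi)"
      using x0 by (simp_all add: wx Arg2pi_of_real flip: of_real_minus)
    have s: "0 < sin \<alpha>" using assms by (simp add: sin_gt_zero)
    have Imz: "Im z = x * sin \<alpha>" using zx by simp
    have Imq: "Im (q z) = x\<^sup>2 * sin \<alpha>"
      by (subst q, subst wx, subst zx) (simp add: power2_eq_square)
    have "F_pot \<alpha> b\<^sub>1 z = G1 z" by (rule F1) (simp add: im)
    also have "\<dots> = G2 z"
    proof (cases "x < 0")
      case True
      then have "max 0 (Im z) = 0" using s by (simp add: Imz mult_neg_pos max_def not_le)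
      then show ?thesis using True by (simp add: G1_def G2_def A)
    next
      case False
      then have m: "max 0 (Im z) = x * sin \<alpha>" using s by (simp add: Imz)
      show ?thesis
        using False by (simp add: G1_def G2_def A m Imq k_def) (simp add: field_simps power2_eq_square)
    qed
    finally show ?thesis .
  qed
  have cw [continuous_intros]: "continuous_on S w" for S
    unfolding w_def by (intro continuous_intros)
  have cq [continuous_intros]: "continuous_on S q" for S
    unfolding q_def by (intro continuous_intros)
  let ?H1 = "{z. z \<noteq> 0 \<and> 0 \<le> Im (w z)}" and ?H2 = "{z. z \<noteq> 0 \<and> Im (w z) \<le> 0}"
  have "continuous_on ?H1 G1"
    unfolding G1_def Complex_eq
    by (intro continuous_intros continuous_on_compose2[OF continuous_on_upperhalf_Arg2pi]) auto
  then have c1: "continuous_on ?H1 (F_pot \<alpha> b\<^sub>1)"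
    by (rule continuous_on_eq) (simp add: F1)
  have "continuous_on ?H2 G2"
    unfolding G2_def Complex_eq
    by (intro continuous_intros continuous_on_compose2[OF continuous_on_upperhalf_Arg2pi]) auto
  then have c2: "continuous_on ?H2 (F_pot \<alpha> b\<^sub>1)"
    by (rule continuous_on_eq) (simp add: F2)
  have cl: "closed {z. 0 \<le> Im (w z)}" "closed {z. Im (w z) \<le> 0}"
    by (intro closed_Collect_le continuous_intros)+
  have "continuous_on (?H1 \<union> ?H2) (F_pot \<alpha> b\<^sub>1)"
  proof (rule continuous_on_Un_local[OF _ _ c1 c2])
    show "closedin (top_of_set (?H1 \<union> ?H2)) ?H1"
      unfolding closedin_closed using cl(1) by (intro exI[of _ "{z. 0 \<le> Im (w z)}"]) auto
    show "closedin (top_of_set (?H1 \<union> ?H2)) ?H2"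
      unfolding closedin_closed using cl(2) by (intro exI[of _ "{z. Im (w z) \<le> 0}"]) auto
  qed
  also have "?H1 \<union> ?H2 = UNIV - {0}" by auto
  finally have off0: "isCont (F_pot \<alpha> b\<^sub>1) z" if "z \<noteq> 0" for z
    using that by (simp add: continuous_on_eq_continuous_at open_delete)
  have "isCont (F_pot \<alpha> b\<^sub>1) 0"
  proof -
    define C where "C = 1 + \<bar>b\<^sub>1\<bar>"
    let ?g = "\<lambda>r::real. C * r\<^sup>2 + \<bar>k\<bar> * (r\<^sup>2 * (\<bar>ln r\<bar> + (\<alpha> + 2 * pi)))"
    have bd: "norm (F_pot \<alpha> b\<^sub>1 z) \<le> ?g (cmod z)" for z
    proof -
      have "(Im z)\<^sup>2 \<le> (cmod z)\<^sup>2"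
        using abs_Im_le_cmod[of z] by (simp flip: abs_le_square_iff)
      then have "\<bar>b\<^sub>1\<bar> * (Im z)\<^sup>2 \<le> \<bar>b\<^sub>1\<bar> * (cmod z)\<^sup>2" "(Im z)\<^sup>2 \<le> (cmod z)\<^sup>2"
        by (auto intro: mult_left_mono)
      then have "\<bar>phi \<alpha> b\<^sub>1 z\<bar> \<le> C * (cmod z)\<^sup>2"
        by (auto simp: phi_def C_def abs_mult algebra_simps intro: order_trans add_increasing)
      moreover have "\<bar>Re (q z * log_branch \<alpha> z)\<bar> \<le> (cmod z)\<^sup>2 * (\<bar>ln (cmod z)\<bar> + (\<alpha> + 2 * pi))"
      proof -
        have "\<bar>Re (q z * log_branch \<alpha> z)\<bar> \<le> cmod (q z) * cmod (log_branch \<alpha> z)"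
          using abs_Re_le_cmod[of "q z * log_branch \<alpha> z"] by (simp add: norm_mult)
        also have "cmod (q z) = (cmod z)\<^sup>2"
          by (simp add: q_def norm_mult norm_power)
        also have "cmod (log_branch \<alpha> z) \<le> \<bar>ln (cmod z)\<bar> + (\<alpha> + 2 * pi)"
          using cmod_le[of "log_branch \<alpha> z"] Arg2pi[of "z * cis (- \<alpha>)"] assms
          by (simp add: log_branch_def)
        finally show ?thesis by (simp add: mult_left_mono)
      qed
      then have "\<bar>k * Re (q z * log_branch \<alpha> z)\<bar>
          \<le> \<bar>k\<bar> * ((cmod z)\<^sup>2 * (\<bar>ln (cmod z)\<bar> + (\<alpha> + 2 * pi)))"
        unfolding abs_mult by (rule mult_left_mono) simp
      ultimately show ?thesis
        unfolding F
        by (simp only: real_norm_def)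
    qed
    have "(?g \<longlongrightarrow> 0) (at_right 0)" by real_asymp
    moreover have "filterlim cmod (at_right 0) (at 0)"
      by (auto simp: filterlim_at eventually_at_filter intro!: tendsto_eq_intros)
    ultimately have "((\<lambda>z. ?g (cmod z)) \<longlongrightarrow> 0) (at 0)"
      by (rule filterlim_compose)
    then have "(F_pot \<alpha> b\<^sub>1 \<longlongrightarrow> 0) (at 0)"
      by (rule Lim_null_comparison[OF always_eventually, rotated]) (use bd in blast)
    moreover have "F_pot \<alpha> b\<^sub>1 0 = 0"
      by (simp add: F_pot_def phi_def)
    ultimately show ?thesis by (simp add: isCont_def)
  qed
  with off0 show ?thesis
    by (metis continuous_at_imp_continuous_on)
qed

end

theory Submission
  imports Defs
begin

text \<open>Every open quadrant avoiding the cut is a region where \<open>Re (q log z)\<close>, \<open>q = (z e\<^bsup>-i\<alpha>/2\<^esup>)\<^sup>2\<close>, is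
  the real part of a holomorphic function, so there that term of the potential can be absorbed into
  \<open>u\<close>. What remains of the weight is \<open>exp (c (Im z)\<^sup>2)\<close>, and
  \<open>2 (Im z)\<^sup>2 = \<bar>z\<bar>\<^sup>2 - Re (z\<^sup>2)\<close> turns it into \<open>exp (c \<bar>z\<bar>\<^sup>2 / 2)\<close> after absorbing \<open>exp (- c z\<^sup>2 / 2)\<close>.
  A holomorphic function with Gaussian decay in all directions of a quadrant vanishes, by a
  Carlson-type argument. For \<open>u e\<^bsup>F\<^esup>\<close> the third quadrant, contained in the second sector, gives
  \<open>c = 1\<close>; for \<open>u e\<^bsup>-F\<^esup>\<close> the first quadrant, contained in the first sector if \<open>\<alpha> > pi/2\<close>, gives
  \<open>c = - b\<^sub>1 > 0\<close>.\<close>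

section \<open>Gaussian decay in a quadrant forces vanishing\<close>

text \<open>With \<open>w = -\<i> z\<^sup>2\<close> in the right half plane, \<open>exp (- k w Ln (1 + w))\<close> costs at most the
  assumed decay of \<open>f\<close> on the boundary, where it is about \<open>exp (k pi/2 \<bar>w\<bar>)\<close>, and eventually beats
  \<open>exp (n w)\<close> inside. So \<open>exp (n w)\<close> can be inserted at no cost for every \<open>n\<close>.\<close>

lemma quadrant_decay_imp_zero:
  assumes holf: "f holomorphic_on {z. 0 \<le> Re z \<and> 0 \<le> Im z}" and c: "0 < c"
    and bound: "\<And>z. 0 \<le> Re z \<Longrightarrow> 0 \<le> Im z \<Longrightarrow> cmod (f z) \<le> C * exp (- c * (cmod z)\<^sup>2)"
    and \<xi>: "0 < Re \<xi>" "0 < Im \<xi>"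
  shows "f \<xi> = 0"
proof -
  \<comment> \<open>The choice gives \<open>k * pi / 2 = c\<close>, so the growth of
    \<open>exp (- P z)\<close> coming from the argument of \<open>1 + w z\<close> is exactly paid
    for by the decay of \<open>f\<close>.\<close>
  define k where "k = 2 * c / pi"
  define w where "w = (\<lambda>z::complex. - \<i> * z\<^sup>2)"
  \<comment> \<open>The shift by 1 keeps \<open>Ln\<close> holomorphic up to the corner, where
    \<open>w\<close> vanishes.\<close>
  define P where "P = (\<lambda>z. of_real k * w z * Ln (1 + w z))"
  have k: "0 < k" using c by (simp add: k_def)
  have C: "0 \<le> C" using bound[of 0] by simp (metis norm_ge_zero order_trans)
  have Re_w: "Re (w z) = 2 * Re z * Im z" for z
    by (simp add: w_def power2_eq_square)
  have norm_w: "cmod (w z) = (cmod z)\<^sup>2" for z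
    by (simp add: w_def norm_mult norm_power)
  \<comment> \<open>In the real part of \<open>w z * Ln (1 + w z)\<close> the product of the real
    parts yields the bracket; the product of the imaginary parts is at most
    \<open>pi / 2 * (cmod z)\<^sup>2\<close>, since \<open>1 + w z\<close> has positive real
    part.\<close>
  have key: "Re (of_nat n * w z - P z) \<le> Re (w z) * (n - k * ln (cmod (1 + w z))) + c * (cmod z)\<^sup>2"
    if "0 \<le> Re z" "0 \<le> Im z" for n :: nat and z
  proof -
    have w0: "0 \<le> Re (w z)" using that by (simp add: Re_w)
    then have "Re (1 + w z) > 0" by simp
    then have nz: "1 + w z \<noteq> 0" by (metis less_irrefl zero_complex.sel(1))
    have "\<bar>Im (Ln (1 + w z))\<bar> \<le> pi / 2"
      using Re_Ln_pos_le[OF nz] w0 by simp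
    then have "\<bar>Im (w z)\<bar> * \<bar>Im (Ln (1 + w z))\<bar> \<le> (cmod z)\<^sup>2 * (pi / 2)"
      using abs_Im_le_cmod[of "w z"] by (intro mult_mono) (auto simp: norm_w)
    then have "Im (w z) * Im (Ln (1 + w z)) \<le> (cmod z)\<^sup>2 * (pi / 2)"
      by (metis abs_ge_self abs_mult order_trans)
    then have "k * (Im (w z) * Im (Ln (1 + w z))) \<le> k * ((cmod z)\<^sup>2 * (pi / 2))"
      using k by (intro mult_left_mono) auto
    also have "\<dots> = c * (cmod z)\<^sup>2" by (simp add: k_def)
    finally show ?thesis
      using nz by (simp add: P_def algebra_simps)
  qed
  have est: "cmod (f z * exp (of_nat n * w z - P z)) \<le> C * exp (Re (w z) * (n - k * ln (cmod (1 + w z))))"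
    if "0 \<le> Re z" "0 \<le> Im z" for n :: nat and z
  proof -
    have "cmod (f z * exp (of_nat n * w z - P z))
        \<le> C * exp (- c * (cmod z)\<^sup>2) * exp (Re (w z) * (n - k * ln (cmod (1 + w z))) + c * (cmod z)\<^sup>2)"
      unfolding norm_mult norm_exp_eq_Re using bound[OF that] key[OF that, of n] C
      by (intro mult_mono) auto
    also have "\<dots> = C * exp (Re (w z) * (n - k * ln (cmod (1 + w z))))"
      by (simp flip: exp_add)
    finally show ?thesis .
  qed
  have le_C: "cmod (f \<xi> * exp (of_nat n * w \<xi> - P \<xi>)) \<le> C" for n :: nat
  proof -
    \<comment> \<open>The first entry puts \<open>\<xi>\<close> inside the sector; the second makes
      \<open>k * ln (cmod (1 + w z))\<close> at least \<open>n\<close> on the arc.\<close>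
    define R where "R = max (cmod \<xi> + 1) (exp (n / k))"
    have R: "cmod \<xi> < R" "exp (n / k) \<le> R" "1 \<le> R" using norm_ge_zero[of \<xi>] by (simp_all add: R_def le_max_iff_disj del: norm_ge_zero)
    define S where "S = {z. 0 < Re z} \<inter> {z. 0 < Im z} \<inter> ball 0 R"
    have opS: "open S"
      unfolding S_def by (intro open_Int open_halfspace_Re_gt open_halfspace_Im_gt open_ball)
    have "closure S \<subseteq> {z. 0 \<le> Re z} \<inter> {z. 0 \<le> Im z} \<inter> cball 0 R"
      by (intro closure_minimal closed_Int closed_halfspace_Re_ge closed_halfspace_Im_ge closed_cball)
        (auto simp: S_def)
    then have clS: "0 \<le> Re z" "0 \<le> Im z" "cmod z \<le> R" if "z \<in> closure S" for z
      using that by auto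
    have pos: "1 + w z \<notin> \<real>\<^sub>\<le>\<^sub>0" if "0 \<le> Re z" "0 \<le> Im z" for z
      using that Re_w[of z] by (auto simp: complex_nonpos_Reals_iff add_nonneg_eq_0_iff)
        (smt (verit) mult_nonneg_nonneg)
    have hol: "(\<lambda>z. f z * exp (of_nat n * w z - P z)) holomorphic_on {z. 0 \<le> Re z \<and> 0 \<le> Im z}"
      unfolding P_def using pos unfolding w_def
      by (intro holomorphic_intros holf) auto
    show ?thesis
    proof (rule maximum_modulus_frontier[of "\<lambda>z. f z * exp (of_nat n * w z - P z)" S])
      show "(\<lambda>z. f z * exp (of_nat n * w z - P z)) holomorphic_on interior S"
        using hol by (rule holomorphic_on_subset) (use interior_subset in \<open>fastforce simp: S_def\<close>)
      show "continuous_on (closure S) (\<lambda>z. f z * exp (of_nat n * w z - P z))"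
        using hol by (intro holomorphic_on_imp_continuous_on) (rule holomorphic_on_subset, use clS in auto)
      show "bounded S" unfolding S_def by (intro bounded_Int) auto
      show "\<xi> \<in> S" using \<xi> R by (simp add: S_def)
      fix z assume z: "z \<in> frontier S"
      then have cl: "0 \<le> Re z" "0 \<le> Im z" "cmod z \<le> R"
        using clS by (auto simp: frontier_def)
      have "z \<notin> S" using z opS by (simp add: frontier_def interior_open)
      \<comment> \<open>On the straight edges \<open>Re (w z) = 0\<close>; on the arc the bracket is
        nonpositive. Either way the bound is \<open>C\<close>, independent of \<open>n\<close> and
        \<open>R\<close>.\<close>
      then consider "Re z = 0 \<or> Im z = 0" | "cmod z = R"
        using cl by (auto simp: S_def)
      then have "Re (w z) * (n - k * ln (cmod (1 + w z))) \<le> 0"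
      proof cases
        case 1
        then show ?thesis by (auto simp: Re_w)
      next
        case 2
        have w0: "0 \<le> Re (w z)" using cl by (simp add: Re_w)
        have "R \<le> R\<^sup>2" using R(3) by (simp add: power2_eq_square)
        also have "\<dots> = cmod (w z)" by (simp add: norm_w 2)
        also have "\<dots> \<le> cmod (1 + w z)"
          using w0 unfolding cmod_def by (intro real_sqrt_le_mono) (simp add: power_mono)
        finally have "exp (n / k) \<le> cmod (1 + w z)" using R(2) by linarith
        then have "n / k \<le> ln (cmod (1 + w z))"
          by (meson exp_gt_zero ln_ge_iff order_less_le_trans)
        then show ?thesis
          using k w0 by (intro mult_nonneg_nonpos) (auto simp: field_simps)
      qed
      then have "C * exp (Re (w z) * (n - k * ln (cmod (1 + w z)))) \<le> C * 1"
        using C by (intro mult_left_mono) auto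
      then show "cmod (f z * exp (of_nat n * w z - P z)) \<le> C"
        using est[OF cl(1,2), of n] by simp
    qed
  qed
  have "0 < Re (w \<xi>)" using \<xi> by (simp add: Re_w)
  then have "(\<lambda>n. C * exp (Re (P \<xi>) - real n * Re (w \<xi>))) \<longlonglongrightarrow> 0"
    by real_asymp
  moreover have "cmod (f \<xi>) \<le> C * exp (Re (P \<xi>) - real n * Re (w \<xi>))" for n :: nat
    using le_C[of n] by (simp add: norm_mult norm_divide exp_diff field_simps)
  ultimately have "cmod (f \<xi>) \<le> 0"
    by (intro LIMSEQ_le_const) auto
  then show ?thesis by simp
qed

section \<open>From weighted square integrability to pointwise decay\<close>

text \<open>Averages of \<open>g\<close> over small squares are holomorphic, decay pointwise, and vanish by the
  previous lemma; the shift \<open>p\<close> keeps the squares inside the quadrant.\<close>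

lemma quadrant_weighted_L2_imp_zero:
  fixes \<sigma> :: complex
  defines "S \<equiv> {z. 0 < Re (cnj \<sigma> * z) \<and> 0 < Im (cnj \<sigma> * z)}"
  assumes \<sigma>: "cmod \<sigma> = 1" and c: "0 < c" and holg: "g holomorphic_on S"
    and int: "(\<lambda>z. (cmod (g z))\<^sup>2 * exp (c * (cmod z)\<^sup>2)) integrable_on S"
    and \<xi>: "\<xi> \<in> S"
  shows "g \<xi> = 0"
proof -
  define W where "W = (\<lambda>z. (cmod (g z))\<^sup>2 * exp (c * (cmod z)\<^sup>2))"
  \<comment> \<open>Points of a square of side at most 1 have modulus at most 2, so the coordinates
    along the rotated axes stay at least 1, even for \<open>z\<close> on the boundary of the
    quadrant.\<close>
  define p where "p = Complex 3 3"
  define Q where "Q = (\<lambda>h. cbox 0 (Complex h h))"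
  define A where "A = (\<lambda>h z. integral (Q h) (\<lambda>s. g (\<sigma> * (p + z) + s)))"
  have S: "S = {z. 0 < Re (cnj \<sigma> * z)} \<inter> {z. 0 < Im (cnj \<sigma> * z)}"
    by (auto simp: S_def)
  have opS: "open S"
    unfolding S by (intro open_Int open_Collect_less continuous_intros)
  have "convex S"
    \<comment> \<open>The real and imaginary parts of \<open>cnj \<sigma> * z\<close> are the inner
      products of \<open>z\<close> with \<open>\<sigma>\<close> and
      \<open>\<i> * \<sigma>\<close>.\<close>
    using convex_Int[OF convex_halfspace_gt[of 0 \<sigma>] convex_halfspace_gt[of 0 "\<i> * \<sigma>"]]
    by (simp add: S inner_complex_def)
  then have conS: "connected S" by (rule convex_connected)
  have rot: "cnj \<sigma> * (\<sigma> * z) = z" for z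
    using \<sigma> complex_norm_square[of \<sigma>] by (simp add: mult.assoc[symmetric] mult.commute)
  have inS: "\<sigma> * (p + z) + s \<in> S" if "0 \<le> Re z" "0 \<le> Im z" "cmod s \<le> 2" for z s
  proof -
    define t where "t = cnj \<sigma> * s"
    have "cmod t \<le> 2" unfolding t_def using that \<sigma> by (simp add: norm_mult)
    then have "\<bar>Re t\<bar> \<le> 2" "\<bar>Im t\<bar> \<le> 2"
      using abs_Re_le_cmod abs_Im_le_cmod order_trans by blast+
    moreover have eq: "cnj \<sigma> * (\<sigma> * (p + z) + s) = p + z + t"
      using rot[of "p + z"] by (simp only: distrib_left[of "cnj \<sigma>" "\<sigma> * (p + z)"] t_def)
    ultimately show ?thesis
      using that unfolding S_def mem_Collect_eq eq by (intro conjI) (simp_all add: p_def)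
  qed
  have Q: "cmod s \<le> 2 * h" if "s \<in> Q h" for s h
    using that cmod_le[of s] by (auto simp: Q_def in_cbox_complex_iff)
  have QS: "\<sigma> * (p + z) + s \<in> S" if "0 \<le> Re z" "0 \<le> Im z" "s \<in> Q h" "h \<le> 1" for z s h
    using inS that Q[of s h] by simp
  have contg: "continuous_on S g" and holg': "deriv g holomorphic_on S"
    using holg opS by (auto intro: holomorphic_on_imp_continuous_on holomorphic_deriv)
  have contQ: "continuous_on (Q h) (\<lambda>s. g (\<sigma> * (p + z) + s))"
    if "0 \<le> Re z" "0 \<le> Im z" "h \<le> 1" for z h
    using QS that by (intro continuous_on_compose2[OF contg] continuous_intros) auto
  have A0: "A h z = 0" if h: "h \<le> 1" and z: "0 < Re z" "0 < Im z" for h z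
  proof -
    let ?V = "{z. 0 \<le> Re z \<and> 0 \<le> Im z}"
    \<comment> \<open>Passing from \<open>W\<close> to \<open>cmod (g x)\<close> halves the exponent
      \<open>c\<close>, and comparing \<open>\<zeta> + s\<close> with \<open>\<zeta>\<close> halves
      it again, whence \<open>c / 4\<close>; the factor \<open>exp (2 * c)\<close> is the cost of
      \<open>cmod s \<le> 2\<close>.\<close>
    define C where "C = exp (2 * c) * (integral S W + measure lborel (Q h))"
    show ?thesis
    proof (rule quadrant_decay_imp_zero[where f = "A h" and \<xi> = z and c = "c / 4" and C = C])
      show "A h holomorphic_on ?V"
        unfolding A_def Q_def
      proof (rule leibniz_rule_holomorphic[where fx = "\<lambda>z s. deriv g (\<sigma> * (p + z) + s) * \<sigma>"])
        fix z s assume "z \<in> ?V" "s \<in> cbox 0 (Complex h h)"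
        then have "(g has_field_derivative deriv g (\<sigma> * (p + z) + s)) (at (\<sigma> * (p + z) + s))"
          using holg opS QS h by (intro holomorphic_derivI) (auto simp: Q_def)
        then show "((\<lambda>z. g (\<sigma> * (p + z) + s)) has_field_derivative deriv g (\<sigma> * (p + z) + s) * \<sigma>)
            (at z within ?V)"
          by (rule DERIV_chain2) (auto intro!: derivative_eq_intros)
      next
        fix z assume "z \<in> ?V"
        then show "(\<lambda>s. g (\<sigma> * (p + z) + s)) integrable_on cbox 0 (Complex h h)"
          using contQ h by (intro integrable_continuous) (auto simp: Q_def)
      next
        have "(\<lambda>(z, s). \<sigma> * (p + z) + s) ` (?V \<times> cbox 0 (Complex h h)) \<subseteq> S"
          using QS h by (auto simp: Q_def)
        then show "continuous_on (?V \<times> cbox 0 (Complex h h))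
            (\<lambda>(z, s). deriv g (\<sigma> * (p + z) + s) * \<sigma>)"
          unfolding case_prod_unfold
          by (intro continuous_intros
              continuous_on_compose2[OF holomorphic_on_imp_continuous_on[OF holg']]) auto
      next
        have "?V = {z. 0 \<le> Re z} \<inter> {z. 0 \<le> Im z}" by auto
        then show "convex ?V"
          by (simp add: convex_Int convex_halfspace_Re_ge convex_halfspace_Im_ge)
      qed
    next
      fix z assume z: "0 \<le> Re z" "0 \<le> Im z"
      define \<zeta> where "\<zeta> = \<sigma> * (p + z)"
      have "(cmod z)\<^sup>2 \<le> (cmod (p + z))\<^sup>2"
        using z unfolding cmod_power2 by (intro add_mono power_mono) (auto simp: p_def)
      then have \<zeta>: "(cmod z)\<^sup>2 \<le> (cmod \<zeta>)\<^sup>2"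
        using \<sigma> by (simp add: \<zeta>_def norm_mult)
      let ?E = "exp (2 * c - c / 4 * (cmod z)\<^sup>2)"
      have ptw: "cmod (g (\<zeta> + s)) \<le> ?E * (W (\<zeta> + s) + 1)" if s: "s \<in> Q h" for s
      proof -
        have s2: "(cmod s)\<^sup>2 \<le> 2\<^sup>2" using Q[OF s] h by (intro power_mono) auto
        have "cmod \<zeta> \<le> cmod (\<zeta> + s) + cmod s"
          by (metis add_diff_cancel_right' norm_triangle_ineq4)
        then have "(cmod \<zeta>)\<^sup>2 \<le> (cmod (\<zeta> + s) + cmod s)\<^sup>2" by (intro power_mono) auto
        also have "\<dots> \<le> 2 * (cmod (\<zeta> + s))\<^sup>2 + 2 * (cmod s)\<^sup>2"
          using zero_le_power2[of "cmod (\<zeta> + s) - cmod s"] by (simp add: power2_sum power2_diff)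
        finally have "(cmod z)\<^sup>2 / 4 - 2 \<le> (cmod (\<zeta> + s))\<^sup>2 / 2" using s2 \<zeta> unfolding power2_eq_square by linarith
        then have "c * ((cmod z)\<^sup>2 / 4 - 2) \<le> c * ((cmod (\<zeta> + s))\<^sup>2 / 2)"
          using c by (intro mult_left_mono) auto
        then have e: "exp (- (c * (cmod (\<zeta> + s))\<^sup>2 / 2)) \<le> ?E" by (simp add: algebra_simps)
        define a where "a = cmod (g (\<zeta> + s)) * exp (c * (cmod (\<zeta> + s))\<^sup>2 / 2)"
        have "a\<^sup>2 = W (\<zeta> + s)"
          by (simp add: a_def W_def power_mult_distrib flip: exp_double)
        \<comment> \<open>This elementary inequality takes the place of Cauchy-Schwarz: on a square
          of finite measure the integral of \<open>W + 1\<close> is enough.\<close>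
        moreover have "a \<le> a\<^sup>2 + 1"
          using zero_le_power2[of "a - 1/2"] by (simp add: power2_eq_square algebra_simps)
        ultimately have a: "a \<le> W (\<zeta> + s) + 1" by simp
        have "cmod (g (\<zeta> + s)) = exp (- (c * (cmod (\<zeta> + s))\<^sup>2 / 2)) * a"
          by (simp add: a_def exp_minus)
        also have "\<dots> \<le> ?E * (W (\<zeta> + s) + 1)"
          using e a by (intro mult_mono) (auto simp: a_def)
        finally show ?thesis .
      qed
      have contW: "continuous_on S W"
        unfolding W_def by (intro continuous_intros contg)
      have intW: "W integrable_on cbox \<zeta> (Complex h h + \<zeta>)"
        and subW: "cbox \<zeta> (Complex h h + \<zeta>) \<subseteq> S"
      proof -
        show "cbox \<zeta> (Complex h h + \<zeta>) \<subseteq> S"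
        proof
          fix x assume "x \<in> cbox \<zeta> (Complex h h + \<zeta>)"
          then have "x - \<zeta> \<in> Q h" by (auto simp: Q_def in_cbox_complex_iff)
          from QS[OF z this h] show "x \<in> S" by (simp add: \<zeta>_def)
        qed
        then show "W integrable_on cbox \<zeta> (Complex h h + \<zeta>)"
          using contW by (intro integrable_continuous) (rule continuous_on_subset)
      qed
      have shift: "((\<lambda>s. W (\<zeta> + s)) has_integral integral (cbox \<zeta> (Complex h h + \<zeta>)) W) (Q h)"
        using has_integral_shift_cbox_iff[of W \<zeta> _ 0 "Complex h h"] integrable_integral[OF intW]
        by (simp add: Q_def o_def)
      have one: "((\<lambda>s. 1) has_integral measure lborel (Q h)) (Q h)"
        using has_integral_const[of "1::real" 0 "Complex h h"] by (simp add: Q_def)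
      have "cmod (A h z) \<le> ?E * (integral (cbox \<zeta> (Complex h h + \<zeta>)) W + measure lborel (Q h))"
        unfolding A_def \<zeta>_def[symmetric]
        using has_integral_mult_right[OF has_integral_add[OF shift one], of ?E] ptw
          contQ[OF z h] \<zeta>_def
        by (intro order_trans[OF integral_norm_bound_integral[of _ _ "\<lambda>s. ?E * (W (\<zeta> + s) + 1)"]])
          (auto simp: Q_def has_integral_iff intro!: integrable_continuous)
      also have "\<dots> \<le> ?E * (integral S W + measure lborel (Q h))"
        using subW intW int
        by (intro mult_left_mono add_right_mono integral_subset_le) (auto simp: W_def)
      also have "\<dots> = C * exp (- (c / 4) * (cmod z)\<^sup>2)"
        by (simp add: C_def flip: exp_add)
      finally show "cmod (A h z) \<le> C * exp (- (c / 4) * (cmod z)\<^sup>2)" .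
    qed (use c z in auto)
  qed
  \<comment> \<open>If \<open>g\<close> were nonzero at a point, then by continuity it would differ
    from that value by at most half its modulus on a small square, so the average there could not
    vanish.\<close>
  have g0: "g (\<sigma> * (p + z)) = 0" if z: "0 < Re z" "0 < Im z" for z
  proof (rule ccontr)
    define \<zeta> where "\<zeta> = \<sigma> * (p + z)"
    assume "g (\<sigma> * (p + z)) \<noteq> 0"
    then have e: "0 < cmod (g \<zeta>) / 2" by (simp add: \<zeta>_def)
    have "\<zeta> \<in> S" using inS[of z 0] z by (simp add: \<zeta>_def)
    then have "isCont g \<zeta>" using contg opS by (simp add: continuous_on_eq_continuous_at)
    then obtain d where d: "0 < d" "\<And>x. dist x \<zeta> < d \<Longrightarrow> dist (g x) (g \<zeta>) < cmod (g \<zeta>) / 2"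
      using e unfolding continuous_at_eps_delta by blast
    \<comment> \<open>The bound 1 is what \<open>A0\<close> requires; \<open>d / 3\<close> gives
      \<open>2 * h < d\<close>, and points of the square have modulus at most
      \<open>2 * h\<close>.\<close>
    define h where "h = min 1 (d / 3)"
    have h: "0 < h" "h \<le> 1" "2 * h < d" using d(1) by (auto simp: h_def)
    have meas: "measure lborel (Q h) = h\<^sup>2"
      using h by (simp add: Q_def content_cbox Basis_complex_def power2_eq_square)
    have "((\<lambda>s. g (\<zeta> + s)) has_integral 0) (Q h)"
      using contQ[of z h] A0[OF h(2) z] z h integrable_continuous[of 0 "Complex h h"]
      by (metis A_def Q_def \<zeta>_def has_integral_integral less_imp_le)
    then have "((\<lambda>s. g (\<zeta> + s) - g \<zeta>) has_integral 0 - measure lborel (Q h) *\<^sub>R g \<zeta>) (Q h)"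
      unfolding Q_def by (intro has_integral_diff has_integral_const)
    then have "cmod (0 - measure lborel (Q h) *\<^sub>R g \<zeta>) \<le> cmod (g \<zeta>) / 2 * measure lborel (Q h)"
      unfolding Q_def
    proof (rule has_integral_bound[rotated])
      fix s assume "s \<in> cbox 0 (Complex h h)"
      then have "cmod s < d" using Q[of s h] h by (simp add: Q_def)
      then show "cmod (g (\<zeta> + s) - g \<zeta>) \<le> cmod (g \<zeta>) / 2"
        using d(2)[of "\<zeta> + s"] by (simp add: dist_norm)
    qed (use e in auto)
    then show False using e h by (simp add: meas)
  qed
  \<comment> \<open>The shift costs nothing: vanishing on the smaller open quadrant spreads to the
    connected set \<open>S\<close> by the identity theorem.\<close>
  define U where "U = {z. 3 < Re (cnj \<sigma> * z)} \<inter> {z. 3 < Im (cnj \<sigma> * z)}"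
  show ?thesis
  proof (rule analytic_continuation_open[of U S g "\<lambda>_. 0"])
    show "open U"
      unfolding U_def by (intro open_Int open_Collect_less continuous_intros)
    have "\<sigma> * (p + p) \<in> U" unfolding U_def Int_iff mem_Collect_eq rot by (simp add: p_def)
    then show "U \<noteq> {}" by auto
    show "U \<subseteq> S" by (auto simp: U_def S_def)
    show "g z = 0" if "z \<in> U" for z
    proof -
      have "\<sigma> * (cnj \<sigma> * z) = z"
        using rot[of z] by (simp only: mult.left_commute[of \<sigma>])
      moreover have "p + (cnj \<sigma> * z - p) = cnj \<sigma> * z" by simp
      moreover have "0 < Re (cnj \<sigma> * z - p)" "0 < Im (cnj \<sigma> * z - p)"
        using that by (simp_all add: U_def p_def)
      ultimately show ?thesis
        using g0[of "cnj \<sigma> * z - p"] by (simp only:)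
    qed
  qed (use opS conS holg \<xi> in auto)
qed

section \<open>Absorbing the logarithmic term into a holomorphic factor\<close>

text \<open>Multiplication by \<open>- cis (- \<alpha>)\<close> carries the cut to that of
  \<open>Ln\<close>. Removing the whole line through the cut leaves a domain that still contains the
  quadrants considered.\<close>

lemma log_branch_holomorphic: "log_branch \<alpha> holomorphic_on {z. Im (z * cis (- \<alpha>)) \<noteq> 0}"
proof (rule holomorphic_transform)
  let ?S = "{z. Im (z * cis (- \<alpha>)) \<noteq> 0}"
  show "(\<lambda>z. Ln (- (z * cis (- \<alpha>))) + \<i> * of_real (\<alpha> + pi)) holomorphic_on ?S"
    by (intro holomorphic_intros) (auto simp: complex_nonpos_Reals_iff simp del: times_complex.sel)
  fix z assume z: "z \<in> ?S"
  define w where "w = z * cis (- \<alpha>)"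
  have "Im w \<noteq> 0" using z by (simp add: w_def)
  then have "Arg2pi w \<noteq> 0" "w \<noteq> 0"
    by (auto simp: Arg2pi_eq_0 complex_is_Real_iff)
  then have "Arg2pi w = Im (Ln (- w)) + pi" "Re (Ln (- w)) = ln (cmod w)"
    using Arg2pi_ge_0[of w] by (auto intro: Arg2pi_Ln)
  moreover have "cmod w = cmod z" by (simp add: w_def norm_mult)
  ultimately show "Ln (- (z * cis (- \<alpha>))) + \<i> * of_real (\<alpha> + pi) = log_branch \<alpha> z"
    by (simp add: log_branch_def complex_eq_iff flip: w_def)
qed

text \<open>On \<open>S\<close> the exponent equals
  \<open>c / 2 * (cmod z)\<^sup>2 - Re (H z)\<close> with \<open>H\<close> holomorphic, so
  \<open>g = u * exp (- H)\<close> carries a purely Gaussian weight and vanishes. The parameters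
  \<open>\<sigma>\<close> and \<open>\<epsilon>\<close> let one argument serve both signs of the
  potential.\<close>

lemma zero_mode_vanishes:
  fixes \<sigma> :: complex and \<epsilon> c :: real
  defines "S \<equiv> {z. 0 < Re (cnj \<sigma> * z) \<and> 0 < Im (cnj \<sigma> * z)}"
  assumes \<sigma>: "cmod \<sigma> = 1" and c: "0 < c" and u: "u holomorphic_on UNIV"
    and cut: "\<And>z. z \<in> S \<Longrightarrow> Im (z * cis (- \<alpha>)) \<noteq> 0"
    and phi: "\<And>z. z \<in> S \<Longrightarrow> \<epsilon> * phi \<alpha> b\<^sub>1 z = c * (Im z)\<^sup>2"
    and L2: "in_L2 (\<lambda>z. u z * of_real (exp (\<epsilon> * F_pot \<alpha> b\<^sub>1 z)))"
  shows "u z = 0"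
proof -
  define k where "k = \<epsilon> * (c0 b\<^sub>1 * sin \<alpha> / (2 * pi))"
  define H where "H = (\<lambda>z. of_real k * ((z * cis (- \<alpha> / 2))\<^sup>2 * log_branch \<alpha> z) + of_real (c / 2) * z\<^sup>2)"
  define g where "g = (\<lambda>z. u z * exp (- H z))"
  have S: "S = {z. 0 < Re (cnj \<sigma> * z)} \<inter> {z. 0 < Im (cnj \<sigma> * z)}"
    by (auto simp: S_def)
  have opS: "open S"
    unfolding S by (intro open_Int open_Collect_less continuous_intros)
  have holg: "g holomorphic_on S"
    unfolding g_def H_def
    by (intro holomorphic_intros holomorphic_on_subset[OF u]
        holomorphic_on_subset[OF log_branch_holomorphic]) (use cut in auto)
  have weight: "(cmod (u z * of_real (exp (\<epsilon> * F_pot \<alpha> b\<^sub>1 z))))\<^sup>2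
      = (cmod (g z))\<^sup>2 * exp (c * (cmod z)\<^sup>2)" if "z \<in> S" for z
  proof -
    have "\<epsilon> * F_pot \<alpha> b\<^sub>1 z
        = \<epsilon> * phi \<alpha> b\<^sub>1 z - k * Re ((z * cis (- \<alpha> / 2))\<^sup>2 * log_branch \<alpha> z)"
      by (simp add: F_pot_def k_def right_diff_distrib del: times_complex.sel)
    also have "\<epsilon> * phi \<alpha> b\<^sub>1 z = c / 2 * (cmod z)\<^sup>2 - c / 2 * Re (z\<^sup>2)"
      unfolding phi[OF that] cmod_power2 by (simp add: power2_eq_square algebra_simps)
    moreover have Re_real: "Re (of_real r * x) = r * Re x" for r x
      by simp
    ultimately have "\<epsilon> * F_pot \<alpha> b\<^sub>1 z = c / 2 * (cmod z)\<^sup>2 + Re (- H z)"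
      by (simp add: H_def Re_real del: times_complex.sel of_real_divide)
    then have "exp (\<epsilon> * F_pot \<alpha> b\<^sub>1 z) = exp (c / 2 * (cmod z)\<^sup>2) * cmod (exp (- H z))"
      by (simp only: norm_exp_eq_Re flip: exp_add)
    then show ?thesis
      by (simp add: g_def norm_mult power_mult_distrib flip: exp_double)
  qed
  have "integrable lebesgue (\<lambda>z. (cmod (u z * of_real (exp (\<epsilon> * F_pot \<alpha> b\<^sub>1 z))))\<^sup>2)"
    using L2 by (simp add: in_L2_def)
  then have "set_integrable lebesgue S (\<lambda>z. (cmod (u z * of_real (exp (\<epsilon> * F_pot \<alpha> b\<^sub>1 z))))\<^sup>2)"
    unfolding set_integrable_def using opS by (intro integrable_mult_indicator) auto
  then have "(\<lambda>z. (cmod (u z * of_real (exp (\<epsilon> * F_pot \<alpha> b\<^sub>1 z))))\<^sup>2) integrable_on S"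
    by (rule set_lebesgue_integral_eq_integral)
  then have int: "(\<lambda>z. (cmod (g z))\<^sup>2 * exp (c * (cmod z)\<^sup>2)) integrable_on S"
    by (rule integrable_eq) (rule weight)
  have u0: "u z = 0" if "z \<in> S" for z
    using quadrant_weighted_L2_imp_zero[OF \<sigma> c, of g z] holg int that by (simp add: g_def S_def)
  have "cnj \<sigma> * (\<sigma> * Complex 1 1) = Complex 1 1"
    using \<sigma> complex_norm_square[of \<sigma>] by (simp add: mult.assoc[symmetric] mult.commute)
  then have "\<sigma> * Complex 1 1 \<in> S" unfolding S_def mem_Collect_eq by (simp only:) simp
  then show ?thesis
    using analytic_continuation_open[of S UNIV u "\<lambda>_. 0" z] u u0 opS by auto
qed

section \<open>Choice of quadrant for each sign\<close>

theorem theorem4p1: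
  fixes b\<^sub>1 :: real
  assumes "- 1 / 2 < b\<^sub>1" and "b\<^sub>1 < 0"
  shows "\<exists>\<delta>>0. \<forall>\<alpha>\<in>{pi - \<delta><..<pi}. \<forall>u :: complex \<Rightarrow> complex.
           u holomorphic_on UNIV \<longrightarrow>
           in_L2 (\<lambda>z. u z * of_real (exp (F_pot \<alpha> b\<^sub>1 z))) \<or>
           in_L2 (\<lambda>z. u z * of_real (exp (- F_pot \<alpha> b\<^sub>1 z))) \<longrightarrow>
           (\<forall>z. u z = 0)"
proof (intro exI[of _ "pi / 2"] conjI ballI allI impI)
  fix \<alpha> u z
  assume "\<alpha> \<in> {pi - pi / 2<..<pi}" and u: "u holomorphic_on UNIV"
    and L2: "in_L2 (\<lambda>z. u z * of_real (exp (F_pot \<alpha> b\<^sub>1 z))) \<or>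
      in_L2 (\<lambda>z. u z * of_real (exp (- F_pot \<alpha> b\<^sub>1 z)))"
  then have \<alpha>: "pi / 2 < \<alpha>" "0 < \<alpha>" "\<alpha> < pi" using pi_gt_zero by auto
  have "cos \<alpha> < 0" using cos_gt_zero_pi[of "pi - \<alpha>"] \<alpha> by simp
  moreover have "0 < sin \<alpha>" using \<alpha> by (simp add: sin_gt_zero)
  \<comment> \<open>The imaginary part is \<open>Im z * cos \<alpha> - Re z * sin \<alpha>\<close>;
    \<open>\<delta> = pi / 2\<close> makes \<open>cos \<alpha>\<close> negative, so both terms are
    negative.\<close>
  ultimately have rot: "Im (z * cis (- \<alpha>)) < 0" if "0 < Re z" "0 < Im z" for z
    using mult_pos_neg[of "Im z" "cos \<alpha>"] mult_pos_pos[of "Re z" "sin \<alpha>"] that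
    by (simp del: mult_pos_pos zero_less_mult_iff mult_less_0_iff)
  from L2 show "u z = 0"
  proof
    assume *: "in_L2 (\<lambda>z. u z * of_real (exp (F_pot \<alpha> b\<^sub>1 z)))"
    show ?thesis
    \<comment> \<open>In the third quadrant \<open>Im z < 0\<close> excludes the first sector;
      \<open>rot\<close> at \<open>- z\<close> shows that the line of the cut is avoided.\<close>
    proof (rule zero_mode_vanishes[where u = u and \<sigma> = "-1" and \<epsilon> = 1 and c = 1])
      fix z assume z: "z \<in> {z. 0 < Re (cnj (- 1) * z) \<and> 0 < Im (cnj (- 1) * z)}"
      then show "Im (z * cis (- \<alpha>)) \<noteq> 0" using rot[of "- z"] by simp
      show "1 * phi \<alpha> b\<^sub>1 z = 1 * (Im z)\<^sup>2"
        using z Omega1_iff[OF \<alpha>(2,3), of z] by (simp add: phi_def)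
    qed (use u * in auto)
  next
    assume *: "in_L2 (\<lambda>z. u z * of_real (exp (- F_pot \<alpha> b\<^sub>1 z)))"
    show ?thesis
    \<comment> \<open>The first quadrant lies in the first sector, where the negative field makes
      \<open>- phi\<close> a positive multiple of \<open>(Im z)\<^sup>2\<close>.\<close>
    proof (rule zero_mode_vanishes[where u = u and \<sigma> = 1 and \<epsilon> = "-1" and c = "- b\<^sub>1"])
      fix z assume z: "z \<in> {z. 0 < Re (cnj 1 * z) \<and> 0 < Im (cnj 1 * z)}"
      then show "Im (z * cis (- \<alpha>)) \<noteq> 0" using rot[of z] by simp
      show "- 1 * phi \<alpha> b\<^sub>1 z = - b\<^sub>1 * (Im z)\<^sup>2"
        using z rot[of z] Omega1_iff[OF \<alpha>(2,3), of z] by (simp add: phi_def)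
    qed (use u * assms in auto)
  qed
qed simp
end
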